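(* Let $Ov(x)$ be the number of overpseudoprimes to base 2 not exceeding $x$. Then $$Ov(x)\le x^{3/4}(1+o(1))\quad (x\to\infty).$$
   Context: For odd $n>1$, $h(n)$ denotes the multiplicative order of $2$ modulo $n$. The cyclotomic cosets of $2$ modulo $n$ are the orbits of the map $a\mapsto 2a \bmod n$ on $\{1,2,\dots,n-1\}$; $r(n)$ denotes the number of distinct cyclotomic cosets of 2 modulo $n$. An odd composite number $n$ is an overpseudoprime to base 2 if $n=r(n)h(n)+1$. *)

theory Defs
  imports
    "HOL-Analysis.Analysis"
    "HOL-Number_Theory.Number_Theory"
    "HOL-Combinatorics.Orbits"
    "HOL-Library.Landau_Symbols"
begin

definition ord2 :: "nat \<Rightarrow> nat" where
  "ord2 n = ord n 2"

(* The library's orbit collects the iterates f^k a with k > 0.  For odd n, doubling modulo n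
   permutes the finite set {1..<n}, so a itself belongs to this set. *)
definition cyclotomic_cosets :: "nat \<Rightarrow> nat set set" where
  "cyclotomic_cosets n = (\<lambda>a. orbit (\<lambda>b. (2 * b) mod n) a) ` {1..<n}"

definition num_cosets :: "nat \<Rightarrow> nat" where
  "num_cosets n = card (cyclotomic_cosets n)"

definition overpseudoprime :: "nat \<Rightarrow> bool" where
  "overpseudoprime n \<longleftrightarrow> odd n \<and> n > 1 \<and> \<not> prime n \<and> n = num_cosets n * ord2 n + 1"

definition Ov :: "real \<Rightarrow> nat" where
  "Ov x = card {n. overpseudoprime n \<and> real n \<le> x}"

end

theory Submission
  imports Defs "HOL-Real_Asymp.Real_Asymp"
begin

text \<open>
  The cosets cover \<open>n - 1\<close> residues and each has at most \<open>h = ord n 2\<close> elements, so for an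
  overpseudoprime \<open>n\<close> each has exactly \<open>h\<close>; looking at the coset of \<open>n / p\<close> shows that all prime
  factors \<open>p\<close> of \<open>n\<close> have order \<open>h\<close>.  There are only \<open>O(h / ln h)\<close> such primes, all congruent
  to 1 modulo \<open>h\<close>.  Let \<open>N(y)\<close> count the integers in \<open>(1, y]\<close> composed of them.  Rankin's trick with
  exponent 1/2 gives \<open>N(y) \<le> c(h) * sqrt y\<close> with \<open>c(h) \<rightarrow> 0\<close>, and the congruence gives
  \<open>N(y) \<le> y / h\<close>.  The first bound is used for \<open>h\<close> up to \<open>H = U * x powr (1/4)\<close>.  For larger \<open>h\<close>
  write \<open>n = p m\<close> with a prime \<open>p \<le> sqrt x\<close> and apply the geometric mean of the two bounds to \<open>m\<close>;
  summed over \<open>p\<close> this is \<open>O(x powr (7/8) * h powr (-3/2))\<close>.  In total \<open>Ov(x)\<close> is at most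
  \<open>o(U * x powr (3/4)) + O(x powr (3/4) / sqrt U)\<close>, and \<open>U\<close> is arbitrary, so even \<open>Ov(x) = o(x powr (3/4))\<close>.
\<close>

section \<open>Rankin's trick for integers composed of given primes\<close>

definition generated_by :: "nat set \<Rightarrow> nat set" where
  "generated_by P = {m. m > 0 \<and> prime_factors m \<subseteq> P}"

text \<open>Rankin's trick counts \<open>m\<close> with weight \<open>sqrt (Y / m)\<close>, and the
  full sum of \<open>1 / sqrt m\<close> is the Euler product; the \<open>- 1\<close> discards
  \<open>m = 1\<close>. Two nested inductions replace the infinite series: one adds a prime
  \<open>p\<close>, the other descends from \<open>Y\<close> to \<open>Y div p\<close>, since a
  cofactor may still be divisible by \<open>p\<close>.\<close>

lemma card_generated_by_le:
  assumes "finite P" "\<And>p. p \<in> P \<Longrightarrow> prime p"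
  shows "real (card {m \<in> generated_by P. 1 < m \<and> m \<le> Y})
    \<le> sqrt (real Y) * ((\<Prod>p\<in>P. 1 / (1 - 1 / sqrt (real p))) - 1)"
  using assms
proof (induction P arbitrary: Y rule: finite_induct)
  case empty
  have "{m \<in> generated_by {}. 1 < m \<and> m \<le> Y} = {}"
    by (auto simp: generated_by_def prime_factorization_empty_iff)
  then show ?case by (simp only: card.empty) simp
next
  case (insert p P)
  define G where "G = (\<Prod>p\<in>P. 1 / (1 - 1 / sqrt (real p)))"
  define q where "q = 1 / sqrt (real p)"
  have p: "prime p" using insert.prems by simp
  have q: "0 < q" "q < 1" using prime_gt_1_nat[OF p] by (auto simp: q_def)
  have G': "(\<Prod>p\<in>insert p P. 1 / (1 - 1 / sqrt (real p))) = G / (1 - q)"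
    using insert.hyps by (simp add: G_def q_def)
  show ?case unfolding G'
  proof (induction Y rule: less_induct)
    case (less Y)
    let ?A = "\<lambda>Q Y. {m \<in> generated_by Q. 1 < m \<and> m \<le> Y}"
    define Z where "Z = Y div p"
    have fin: "finite (?A Q Y)" for Q Y by (rule finite_subset[of _ "{..Y}"]) auto
    \<comment> \<open>\<open>B\<close> contains the cofactors \<open>m / p\<close> of the multiples
      of \<open>p\<close>. The element 1 accounts for \<open>m = p\<close>, which occurs only when
      \<open>p \<le> Y\<close>, that is, when \<open>Z > 0\<close>.\<close>
    define B where "B = (if Z = 0 then {} else insert 1 (?A (insert p P) Z))"
    have "?A (insert p P) Y \<subseteq> ?A P Y \<union> (\<lambda>m. p * m) ` B"
    proof
      fix m assume m: "m \<in> ?A (insert p P) Y"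
      show "m \<in> ?A P Y \<union> (\<lambda>m. p * m) ` B"
      proof (cases "p dvd m")
        case True
        then obtain k where k: "m = p * k" by blast
        have "k > 0" using m k by (auto intro: Nat.gr0I)
        moreover have "k \<le> Z" using m k p
          by (simp add: Z_def less_eq_div_iff_mult_less_eq mult.commute prime_gt_0_nat)
        moreover have "prime_factors k \<subseteq> insert p P"
          using m k dvd_prime_factors[of m k] by (auto simp: generated_by_def)
        ultimately have "k \<in> B" by (auto simp: B_def generated_by_def)
        then show ?thesis using k by blast
      next
        case False
        then show ?thesis using m by (auto simp: generated_by_def)
      qed
    qed
    then have "card (?A (insert p P) Y) \<le> card (?A P Y \<union> (\<lambda>m. p * m) ` B)"
      using fin by (intro card_mono) (auto simp: B_def)
    also have "\<dots> \<le> card (?A P Y) + card B"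
      by (rule order_trans[OF card_Un_le]) (simp add: B_def card_image_le fin)
    finally have 1: "real (card (?A (insert p P) Y)) \<le> real (card (?A P Y)) + real (card B)"
      by linarith
    have 2: "real (card (?A P Y)) \<le> sqrt (real Y) * (G - 1)"
      unfolding G_def using insert by auto
    have "G \<ge> 1" unfolding G_def
    proof (rule prod_ge_1)
      fix r assume "r \<in> P"
      then have "r > 1" using insert.prems prime_gt_1_nat by auto
      then show "1 \<le> 1 / (1 - 1 / sqrt (real r))" by (simp add: field_simps)
    qed
    then have Gq: "G / (1 - q) \<ge> 1" using q by (simp add: field_simps)
    have "real (card B) \<le> sqrt (real Z) * (G / (1 - q))"
    proof (cases "Z = 0")
      case False
      then have "Z < Y" unfolding Z_def using prime_gt_1_nat[OF p]
        by (metis div_0 div_less_dividend gr0I)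
      from less.IH[OF this] have "real (card (?A (insert p P) Z)) \<le> sqrt Z * (G / (1 - q) - 1)" .
      moreover have "card B \<le> Suc (card (?A (insert p P) Z))"
        using False fin[of "insert p P" Z] by (simp add: B_def)
      then have "real (card B) \<le> 1 + real (card (?A (insert p P) Z))" by linarith
      \<comment> \<open>The cofactor 1 is paid for by the \<open>- 1\<close> in the induction
        hypothesis, which is worth \<open>sqrt Z \<ge> 1\<close>.\<close>
      moreover have "1 \<le> sqrt (real Z)" using False by simp
      ultimately show ?thesis unfolding right_diff_distrib by linarith
    qed (simp add: B_def)
    also have "\<dots> \<le> (sqrt (real Y) * q) * (G / (1 - q))"
    proof (rule mult_right_mono)
      have "sqrt (real Z) \<le> sqrt (real Y / real p)"
        unfolding Z_def by (simp add: of_nat_div_le_of_nat)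
      then show "sqrt (real Z) \<le> sqrt (real Y) * q" by (simp add: q_def real_sqrt_divide)
    qed (use Gq in linarith)
    finally have "real (card (?A (insert p P) Y)) \<le> sqrt (real Y) * (G - 1 + q * (G / (1 - q)))"
      using 1 2 by (simp add: algebra_simps)
    also have "G - 1 + q * (G / (1 - q)) = G / (1 - q) - 1"
      using q by (simp add: field_simps)
    finally show ?case .
  qed
qed

section \<open>Elementary estimates for sums of powers\<close>

text \<open>The k-th smallest element of \<open>I\<close> is at least \<open>k\<close>, so the worst
  case is an initial segment of the positive integers. The bound depends on \<open>card I\<close>
  only, which suits index sets known only by their size.\<close>

lemma sum_inverse_sqrt_le:
  fixes I :: "nat set"
  assumes "finite I" "0 \<notin> I"
  shows "(\<Sum>i\<in>I. 1 / sqrt (real i)) \<le> 2 * sqrt (real (card I))"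
  using assms
proof (induction I rule: finite_linorder_max_induct)
  case (insert b A)
  define k where "k = card A"
  have "A \<subseteq> {1..<b}" using insert by (auto simp: Suc_le_eq intro: Nat.gr0I)
  then have "card A \<le> b - 1" using card_mono[of "{1..<b}" A] by simp
  then have kb: "Suc k \<le> b" using insert.prems by (cases b) (auto simp: k_def)
  have bA: "b \<notin> A" using insert by blast
  have "(\<Sum>i\<in>insert b A. 1 / sqrt (real i)) \<le> 1 / sqrt (real b) + 2 * sqrt (real k)"
    using insert bA by (simp add: k_def)
  also have "\<dots> \<le> 1 / sqrt (real (Suc k)) + 2 * sqrt (real k)"
    using kb by (intro add_right_mono divide_left_mono) auto
  also have "\<dots> \<le> 2 * sqrt (real (Suc k))"
  proof -
    define u v where "u = sqrt (real k)" and "v = sqrt (real (Suc k))"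
    have uv: "v > 0" "u^2 + 1 = v^2" by (auto simp: u_def v_def)
    have "0 \<le> (v - u)^2" by simp
    then have "1 + 2 * u * v \<le> 2 * v * v" using uv by (simp add: power2_eq_square algebra_simps)
    then have "1 / v + 2 * u \<le> 2 * v" using uv by (simp add: field_simps)
    then show ?thesis by (simp add: u_def v_def)
  qed
  finally show ?case using insert bA by (simp add: k_def)
qed simp

text \<open>Telescoping: for the fourth roots \<open>a\<close> of \<open>n + 1\<close> and
  \<open>b\<close> of \<open>n\<close>, factoring \<open>1 = a^4 - b^4\<close> gives
  \<open>1 \<le> 4 * a^3 * (a - b)\<close>.\<close>

lemma sum_powr_three_quarters_le:
  "(\<Sum>i=1..n. real i powr (-3/4)) \<le> 4 * real n powr (1/4)"
proof (induction n)
  case (Suc n)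
  define a b where "a = real (Suc n) powr (1/4)" and "b = real n powr (1/4)"
  have ab: "0 < a" "0 \<le> b" "b \<le> a" by (auto simp: a_def b_def intro!: powr_mono2)
  have a4: "a ^ 4 = real (Suc n)" unfolding a_def
    by (subst powr_realpow[symmetric]) (auto simp: powr_powr)
  have b4: "b ^ 4 = real n" unfolding b_def
    by (cases "n = 0") (auto simp: powr_powr powr_realpow[symmetric] simp del: powr_realpow)
  have a3: "real (Suc n) powr (-3/4) = 1 / a ^ 3"
    unfolding a_def by (subst powr_realpow[symmetric]) (auto simp: powr_powr powr_minus_divide)
  have "b * b \<le> a * a" "b * a \<le> a * a" using ab by (auto intro!: mult_mono)
  then have "b*b*b \<le> a*a*a" "a*(b*b) \<le> a*(a*a)" "a*(b*a) \<le> a*(a*a)"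
    using ab by (auto intro!: mult_mono)
  then have "(a^3 + a^2*b + a*b^2 + b^3) \<le> 4 * a^3"
    by (simp add: power2_eq_square power3_eq_cube algebra_simps)
  then have "(a - b) * (a^3 + a^2*b + a*b^2 + b^3) \<le> (a - b) * (4 * a^3)"
    using ab by (intro mult_left_mono) auto
  moreover have "(a - b) * (a^3 + a^2*b + a*b^2 + b^3) = a^4 - b^4"
    by (simp add: power2_eq_square power3_eq_cube power4_eq_xxxx algebra_simps)
  ultimately have "1 \<le> (a - b) * (4 * a^3)" using a4 b4 by simp
  then have "1 / a^3 + 4 * b \<le> 4 * a" using ab by (simp add: field_simps)
  then show ?case using Suc a3 by (simp add: a_def b_def)
qed simp

lemma sum_powr_three_halves_tail_le:
  assumes "H > 0"
  shows "(\<Sum>h\<in>{H<..N}. real h powr (-3/2)) \<le> 2 / sqrt (real H)"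
proof -
  have step: "real (Suc n) powr (-3/2) \<le> 2 / sqrt (real n) - 2 / sqrt (real (Suc n))" if "n > 0" for n
  proof -
    define u v where "u = sqrt (real n)" and "v = sqrt (real (Suc n))"
    have uv: "u > 0" "v > 0" "v^2 = u^2 + 1" "u \<le> v" using that by (auto simp: u_def v_def)
    have v3: "real (Suc n) powr (-3/2) = 1 / v ^ 3"
      unfolding v_def powr_half_sqrt[symmetric, OF of_nat_0_le_iff]
      by (subst powr_realpow[symmetric]) (auto simp: powr_powr powr_minus_divide)
    have "(v - u) * (v + u) = 1" using uv by (simp add: power2_eq_square algebra_simps)
    moreover have "(v - u) * (v + u) \<le> (v - u) * (2 * v)" using uv by (intro mult_left_mono) auto
    ultimately have A: "1 \<le> 2 * v * (v - u)" by (simp add: algebra_simps)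
    have "u \<le> v * (2 * v * (v - u))" using mult_mono[OF \<open>u \<le> v\<close> A] uv by simp
    then have "1 / v^3 \<le> 2 / u - 2 / v"
      using uv by (simp add: field_simps power3_eq_cube)
    then show ?thesis using v3 by (simp add: u_def v_def)
  qed
  \<comment> \<open>Summing \<open>step\<close> telescopes. The \<open>max\<close> keeps the bound
    valid, with value 0, while the range is still empty.\<close>
  have "(\<Sum>h\<in>{H<..N}. real h powr (-3/2)) \<le> 2 / sqrt (real H) - 2 / sqrt (real (max H N))"
  proof (induction N)
    case (Suc N)
    show ?case
    proof (cases "H \<le> N")
      case True
      then have "{H<..Suc N} = insert (Suc N) {H<..N}" by auto
      then show ?thesis using Suc step[of N] assms True by (simp add: max_def)
    next
      case False
      then have "{H<..Suc N} = {}" "max H (Suc N) = H" by auto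
      then show ?thesis by simp
    qed
  qed simp
  also have "\<dots> \<le> 2 / sqrt (real H)" by simp
  finally show ?thesis .
qed

section \<open>Doubling orbits and the prime factors of overpseudoprimes\<close>

lemma doubling_funpow:
  assumes "a < n"
  shows "((\<lambda>b. (2 * b) mod n) ^^ j) a = 2 ^ j * a mod (n::nat)"
  using assms by (induction j) (auto simp: mod_mult_right_eq mult.assoc)

text \<open>Here \<open>k\<close> is any positive period of \<open>a\<close>: below it is
  \<open>ord n 2\<close> for a general residue and \<open>ord p 2\<close> for the residue
  \<open>n / p\<close>. Although \<open>orbit\<close> starts at the first iterate, \<open>a\<close>
  belongs to it as its own k-th iterate.\<close>

lemma card_doubling_orbit_le:
  fixes a n k :: nat
  assumes "a < n" "k > 0" "[2 ^ k * a = a] (mod n)"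
  shows "card (orbit (\<lambda>b. (2 * b) mod n) a) \<le> k"
    and "a \<in> orbit (\<lambda>b. (2 * b) mod n) a"
    and "finite (orbit (\<lambda>b. (2 * b) mod n) a)"
proof -
  let ?O = "orbit (\<lambda>b. (2 * b) mod n) a"
  have period: "[2 ^ (k * q) * a = a] (mod n)" for q
  proof (induction q)
    case (Suc q)
    have "[2 ^ (k * q) * (2 ^ k * a) = 2 ^ (k * q) * a] (mod n)"
      using assms(3) by (intro cong_mult cong_refl)
    then have "[2 ^ (k * Suc q) * a = 2 ^ (k * q) * a] (mod n)"
      by (simp add: power_add mult_ac)
    then show ?case using Suc cong_trans by blast
  qed simp
  have sub: "?O \<subseteq> (\<lambda>j. 2 ^ j * a mod n) ` {..<k}"
  proof
    fix y assume "y \<in> ?O"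
    then obtain j where y: "y = 2 ^ j * a mod n"
      using doubling_funpow[OF assms(1)] by (auto simp: orbit_altdef)
    have "[2 ^ (j mod k) * (2 ^ (k * (j div k)) * a) = 2 ^ (j mod k) * a] (mod n)"
      using period by (intro cong_mult cong_refl)
    moreover have "2 ^ (j mod k) * (2 ^ (k * (j div k)) * a) = 2 ^ j * a"
      by (metis mod_mult_div_eq mult.assoc power_add)
    ultimately have "y = 2 ^ (j mod k) * a mod n" using y by (simp add: cong_def)
    then show "y \<in> (\<lambda>j. 2 ^ j * a mod n) ` {..<k}" using assms(2) by auto
  qed
  then show "finite ?O" by (rule finite_subset) simp
  have "card ?O \<le> card ((\<lambda>j. 2 ^ j * a mod n) ` {..<k})" using sub by (intro card_mono) auto
  also have "\<dots> \<le> k" using card_image_le[of "{..<k}"] by simp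
  finally show "card ?O \<le> k" .
  show "a \<in> ?O"
    using assms doubling_funpow[OF assms(1), of k] by (force simp: orbit_altdef cong_def)
qed

lemma overpseudoprime_ord_prime_factor:
  assumes "overpseudoprime n" "prime p" "p dvd n"
  shows "ord p 2 = ord n 2"
proof -
  let ?O = "\<lambda>a. orbit (\<lambda>b. (2 * b) mod n) a"
  define h where "h = ord n 2"
  have n: "odd n" "n > 1" "n = card (cyclotomic_cosets n) * h + 1"
    using assms(1) by (auto simp: overpseudoprime_def num_cosets_def ord2_def h_def)
  have cop: "coprime n 2" using n(1) by simp
  have h0: "h > 0" using cop by (simp add: h_def)
  have per: "[2 ^ h * a = a] (mod n)" for a
    using cong_mult[OF ord[of 2 n] cong_refl[of a]] by (simp add: h_def)
  have orb: "card (?O a) \<le> h" "a \<in> ?O a" "finite (?O a)" if "a \<in> {1..<n}" for a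
    using card_doubling_orbit_le[OF _ h0 per, of a] that by auto
  have fin: "finite (cyclotomic_cosets n)" by (simp add: cyclotomic_cosets_def)
  have cov: "{1..<n} \<subseteq> \<Union> (cyclotomic_cosets n)"
    using orb(2) by (auto simp: cyclotomic_cosets_def)
  have "n - 1 = card {1..<n}" by simp
  also have "\<dots> \<le> card (\<Union> (cyclotomic_cosets n))"
    using cov fin orb(3) by (intro card_mono finite_Union) (auto simp: cyclotomic_cosets_def)
  also have "\<dots> \<le> (\<Sum>C\<in>cyclotomic_cosets n. card C)"
    by (rule card_Union_le_sum_card)
  finally have le: "card (cyclotomic_cosets n) * h \<le> (\<Sum>C\<in>cyclotomic_cosets n. card C)"
    using n(3) by simp
  \<comment> \<open>By \<open>le\<close> the coset sizes average at least \<open>h\<close>, while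
    none exceeds \<open>h\<close>; one smaller coset would be a contradiction.\<close>
  have full: "card C = h" if "C \<in> cyclotomic_cosets n" for C
  proof (rule ccontr)
    assume "card C \<noteq> h"
    then have "card C < h" using that orb(1) by (fastforce simp: cyclotomic_cosets_def)
    then have "(\<Sum>C\<in>cyclotomic_cosets n. card C) < (\<Sum>C\<in>cyclotomic_cosets n. h)"
      using that fin orb(1) by (intro sum_strict_mono_ex1) (auto simp: cyclotomic_cosets_def)
    then show False using le by simp
  qed
  have "odd p" using assms(3) n(1) by auto
  then have copp: "coprime p 2" by simp
  obtain a where a: "n = p * a" using assms(3) by blast
  have a1: "a \<in> {1..<n}"
    using a n(2) prime_gt_1_nat[OF assms(2)] by (auto simp: Suc_le_eq intro: Nat.gr0I)
  \<comment> \<open>Multiplying the congruence modulo \<open>p\<close> and its modulus by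
    \<open>a = n / p\<close> turns it into one modulo \<open>n\<close>. So \<open>ord p 2\<close> is
    a period of \<open>a\<close>, whose coset has \<open>h\<close> elements.\<close>
  have "[2 ^ ord p 2 * a = 1 * a] (mod (p * a))"
    using ord[of 2 p] unfolding cong_def by (simp only: mod_mult_mult2)
  then have "card (?O a) \<le> ord p 2"
    using card_doubling_orbit_le(1)[of a n "ord p 2"] a a1 copp by simp
  then have "h \<le> ord p 2" using full a1 by (auto simp: cyclotomic_cosets_def)
  moreover have "ord p 2 dvd h"
    using cong_modulus_mult_nat[of "2 ^ h" 1 p a] ord[of 2 n] a
    by (simp add: ord_divides[symmetric] h_def)
  ultimately show ?thesis using dvd_imp_le[of "ord p 2" h] h0 by (simp add: h_def)
qed

section \<open>Primes modulo which 2 has a given order\<close>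

text \<open>For \<open>h > 0\<close> these are the primitive prime divisors of
  \<open>2 ^ h - 1\<close>.\<close>

definition order_primes :: "nat \<Rightarrow> nat set" where
  "order_primes h = {p. prime p \<and> ord p 2 = h}"

lemma order_primes_form:
  assumes "p \<in> order_primes h" "h > 0"
  obtains i where "i > 0" "p = i * h + 1"
proof -
  have p: "prime p" "ord p 2 = h" using assms by (auto simp: order_primes_def)
  \<comment> \<open>By convention \<open>ord\<close> is 0 in the non-coprime case, so
    \<open>h > 0\<close> excludes \<open>p = 2\<close>.\<close>
  then have "coprime p 2" using assms(2) by (metis ord_not_coprime less_irrefl)
  then have "h dvd p - 1"
    using order_divides_totient[of p 2] p by (simp add: totient_prime)
  then obtain i where i: "p - 1 = h * i" by blast
  with prime_gt_1_nat[OF p(1)] show ?thesis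
    by (intro that[of i]) (auto intro: Nat.gr0I simp: mult.commute)
qed

lemma order_primes_ge_3:
  assumes "p \<in> order_primes h" "h > 0"
  shows "p \<ge> 3"
proof -
  have "prime p" "p \<noteq> 2" using assms by (auto simp: order_primes_def)
  then show ?thesis using prime_ge_2_nat[of p] by linarith
qed

lemma prod_primes_dvd:
  fixes P :: "nat set"
  assumes "finite P" "\<And>p. p \<in> P \<Longrightarrow> prime p" "\<And>p. p \<in> P \<Longrightarrow> p dvd m"
  shows "\<Prod>P dvd m"
  using assms
proof (induction P rule: finite_induct)
  case (insert p P)
  have "coprime p (\<Prod>P)"
    using insert by (intro prod_coprime_right) (metis insertCI primes_coprime)
  then show ?case using insert by (simp add: divides_mult)
qed simp

text \<open>These primes all divide \<open>2 ^ h - 1\<close>, hence so does their product, and each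
  is at least \<open>h + 1\<close>. Taking logarithms, there are at most
  \<open>h * ln 2 / ln (h + 1)\<close> of them.\<close>

lemma order_primes_card:
  assumes "h > 0"
  shows "finite (order_primes h)" "(h + 1) ^ card (order_primes h) \<le> 2 ^ h"
proof -
  have dvd: "p dvd 2 ^ h - 1" if "p \<in> order_primes h" for p
  proof -
    have "[2 ^ h = 1] (mod p)" using that ord[of 2 p] by (auto simp: order_primes_def)
    then show ?thesis using cong_to_1_nat by blast
  qed
  have pos: "(2::nat) ^ h - 1 > 0" using assms one_less_power[of "2::nat" h] by simp
  show fin: "finite (order_primes h)"
    by (rule finite_subset[of _ "{..2 ^ h - 1}"]) (use dvd dvd_imp_le pos in auto)
  have "(h + 1) ^ card (order_primes h) \<le> \<Prod>(order_primes h)"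
  proof -
    have "(\<Prod>p\<in>order_primes h. h + 1) \<le> (\<Prod>p\<in>order_primes h. p)"
    proof (rule prod_mono)
      fix p assume "p \<in> order_primes h"
      then obtain i where "i > 0" "p = i * h + 1" using order_primes_form assms by blast
      then show "0 \<le> h + 1 \<and> h + 1 \<le> p" by simp
    qed
    then show ?thesis by simp
  qed
  also have "\<dots> \<le> 2 ^ h - 1"
    using fin dvd pos by (intro dvd_imp_le prod_primes_dvd) (auto simp: order_primes_def)
  finally show "(h + 1) ^ card (order_primes h) \<le> 2 ^ h" by linarith
qed

text \<open>With \<open>s = sqrt p\<close> the left side is \<open>1 + 1 / (s - 1)\<close>, which is
  at most \<open>1 + 3 / s\<close> exactly when \<open>s \<ge> 3/2\<close>. This holds for
  \<open>p \<ge> 3\<close> but fails for \<open>p = 2\<close>.\<close>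

lemma inverse_one_minus_le_exp:
  assumes "p \<ge> 3"
  shows "1 / (1 - 1 / sqrt (real p)) \<le> exp (3 / sqrt (real p))"
proof -
  define s where "s = sqrt (real p)"
  have "3/2 \<le> s" unfolding s_def using assms by (intro real_le_rsqrt) (simp add: power2_eq_square)
  then have "1 / (1 - 1 / s) \<le> 1 + 3 / s" by (simp add: field_simps)
  also have "\<dots> \<le> exp (3 / s)" by (rule exp_ge_add_one_self)
  finally show ?thesis by (simp add: s_def)
qed

text \<open>Each prime is \<open>i * h + 1 > i * h\<close> with its own \<open>i\<close>, recovered
  by \<open>?g\<close>. The factor \<open>1 / sqrt h\<close> comes out, and the sum over the
  \<open>i\<close> is bounded through their number.\<close>

lemma sum_order_primes_inverse_sqrt_le:
  assumes "h > 0"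
  shows "(\<Sum>p\<in>order_primes h. 1 / sqrt (real p)) \<le> 2 * sqrt (card (order_primes h) / h)"
proof -
  let ?P = "order_primes h" and ?g = "\<lambda>p. (p - 1) div h"
  have fin: "finite ?P" by (rule order_primes_card(1)[OF assms])
  have form: "?g p > 0 \<and> p = ?g p * h + 1" if "p \<in> ?P" for p
  proof -
    from order_primes_form[OF that assms] obtain i where "i > 0" "p = i * h + 1" by blast
    then show ?thesis using assms by simp
  qed
  have inj: "inj_on ?g ?P"
  proof (rule inj_onI)
    fix p q assume "p \<in> ?P" "q \<in> ?P" "?g p = ?g q"
    then show "p = q" using form[of p] form[of q] by simp
  qed
  have "(\<Sum>p\<in>?P. 1 / sqrt (real p)) \<le> (\<Sum>p\<in>?P. 1 / sqrt (real (?g p)) * (1 / sqrt (real h)))"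
  proof (rule sum_mono)
    fix p assume p: "p \<in> ?P"
    have "?g p * h \<le> p" using form[OF p] by linarith
    then have "sqrt (real (?g p) * real h) \<le> sqrt (real p)"
      by (metis of_nat_le_iff of_nat_mult real_sqrt_le_mono)
    then have "sqrt (real (?g p)) * sqrt (real h) \<le> sqrt (real p)"
      by (simp add: real_sqrt_mult)
    moreover have "0 < sqrt (real (?g p)) * sqrt (real h)" using form[OF p] assms by simp
    ultimately have "1 / sqrt (real p) \<le> 1 / (sqrt (real (?g p)) * sqrt (real h))"
      by (intro frac_le) simp_all
    then show "1 / sqrt (real p) \<le> 1 / sqrt (real (?g p)) * (1 / sqrt (real h))" by simp
  qed
  also have "\<dots> = (\<Sum>i\<in>?g ` ?P. 1 / sqrt (real i)) * (1 / sqrt (real h))"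
    by (simp only: sum_distrib_right sum.reindex[OF inj] o_def)
  also have "\<dots> \<le> 2 * sqrt (card (?g ` ?P)) * (1 / sqrt (real h))"
  proof (intro mult_right_mono sum_inverse_sqrt_le)
    show "0 \<notin> ?g ` ?P"
    proof
      assume "0 \<in> ?g ` ?P"
      then obtain p where "p \<in> ?P" "?g p = 0" by auto
      then show False using form[of p] by simp
    qed
  qed (use fin in auto)
  also have "\<dots> = 2 * sqrt (card ?P / h)"
    by (simp only: card_image[OF inj] real_sqrt_divide) simp
  finally show ?thesis .
qed

section \<open>Counting integers composed of primes of order h\<close>

text \<open>This is an upper bound for the Euler product minus 1. The ratio of logarithms bounds
  \<open>card (order_primes h) / h\<close>, and 6 is the 3 from the Euler factors times the 2 from
  the sum of \<open>1 / sqrt p\<close>.\<close>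

definition rankin_const :: "nat \<Rightarrow> real" where
  "rankin_const h = exp (6 * sqrt (ln 2 / ln (real h + 1))) - 1"

lemma rankin_const_tendsto: "rankin_const \<longlonglongrightarrow> 0"
  unfolding rankin_const_def by real_asymp

lemma rankin_const_bounds:
  assumes "h > 0"
  shows "0 \<le> rankin_const h" "rankin_const h \<le> exp 6"
proof -
  have "ln 2 \<le> ln (real h + 1)" using assms by simp
  moreover have "ln (2::real) > 0" by simp
  ultimately have "ln 2 / ln (real h + 1) \<le> 1" "0 \<le> ln 2 / ln (real h + 1)" by (auto simp: field_simps)
  then have "sqrt (ln 2 / ln (real h + 1)) \<le> 1" "0 \<le> sqrt (ln 2 / ln (real h + 1))" by auto
  then have "exp 0 \<le> exp (6 * sqrt (ln 2 / ln (real h + 1)))"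
    "exp (6 * sqrt (ln 2 / ln (real h + 1))) \<le> exp 6" by (auto simp del: exp_zero)
  then show "0 \<le> rankin_const h" "rankin_const h \<le> exp 6"
    unfolding rankin_const_def exp_zero by linarith+
qed

abbreviation generated_upto :: "nat \<Rightarrow> nat \<Rightarrow> nat set" where
  "generated_upto h Y \<equiv> {m \<in> generated_by (order_primes h). 1 < m \<and> m \<le> Y}"

lemma finite_generated_upto: "finite (generated_upto h Y)"
  by (rule finite_subset[of _ "{..Y}"]) auto

lemma card_generated_upto_le_sqrt:
  assumes "h > 0"
  shows "real (card (generated_upto h Y)) \<le> sqrt (real Y) * rankin_const h"
proof -
  let ?P = "order_primes h"
  have fin: "finite ?P" and le: "(h + 1) ^ card ?P \<le> 2 ^ h"
    using order_primes_card assms by auto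
  have "ln ((real h + 1) ^ card ?P) \<le> ln (2 ^ h)"
    using le by (subst ln_le_cancel_iff) (auto simp flip: of_nat_le_iff[where 'a=real] simp: add.commute)
  then have "card ?P * ln (real h + 1) \<le> h * ln 2" using assms by (simp add: ln_realpow)
  then have ratio: "card ?P / h \<le> ln 2 / ln (real h + 1)" using assms by (simp add: field_simps)
  have "(\<Prod>p\<in>?P. 1 / (1 - 1 / sqrt (real p))) \<le> (\<Prod>p\<in>?P. exp (3 / sqrt (real p)))"
  proof (rule prod_mono)
    fix p assume "p \<in> ?P"
    then have "p \<ge> 3" using order_primes_ge_3 assms by blast
    then show "0 \<le> 1 / (1 - 1 / sqrt (real p)) \<and> 1 / (1 - 1 / sqrt (real p)) \<le> exp (3 / sqrt (real p))"
      using inverse_one_minus_le_exp by (auto simp: field_simps)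
  qed
  also have "\<dots> = exp (3 * (\<Sum>p\<in>?P. 1 / sqrt (real p)))"
    by (simp add: exp_sum[OF fin] sum_distrib_left)
  also have "\<dots> \<le> exp (3 * (2 * sqrt (ln 2 / ln (real h + 1))))"
    using order_trans[OF sum_order_primes_inverse_sqrt_le[OF assms]
        mult_left_mono[OF real_sqrt_le_mono[OF ratio], of 2]] by simp
  finally have "(\<Prod>p\<in>?P. 1 / (1 - 1 / sqrt (real p))) - 1 \<le> rankin_const h"
    by (simp add: rankin_const_def)
  then have "sqrt (real Y) * ((\<Prod>p\<in>?P. 1 / (1 - 1 / sqrt (real p))) - 1) \<le> sqrt (real Y) * rankin_const h"
    by (intro mult_left_mono) auto
  then show ?thesis
    using card_generated_by_le[OF fin, of Y] by (force simp: order_primes_def)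
qed

lemma cong_1_if_prime_factors:
  fixes m h :: nat
  assumes "m > 0" "\<And>p. prime p \<Longrightarrow> p dvd m \<Longrightarrow> [p = 1] (mod h)"
  shows "[m = 1] (mod h)"
  using assms
proof (induction m rule: less_induct)
  case (less m)
  show ?case
  proof (cases "m = 1")
    case False
    then obtain p where p: "prime p" "p dvd m" using prime_factor_nat by blast
    then obtain k where k: "m = p * k" by blast
    have "0 < k" "k < m" using k less.prems prime_gt_1_nat[OF p(1)] by (auto intro: Nat.gr0I)
    then have "[k = 1] (mod h)" using less.IH less.prems k by (metis dvd_mult)
    then have "[p * k = 1 * 1] (mod h)" using less.prems p by (intro cong_mult) auto
    then show ?thesis using k by simp
  qed simp
qed

text \<open>All prime factors are 1 modulo \<open>h\<close>, so \<open>m = i * h + 1\<close>. Since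
  \<open>m > 1\<close> rules out \<open>i = 0\<close>, no extra summand 1 appears.\<close>

lemma card_generated_upto_le_div:
  assumes "h > 0"
  shows "real (card (generated_upto h Y)) \<le> real Y / real h"
proof -
  have "generated_upto h Y \<subseteq> (\<lambda>i. i * h + 1) ` {1..Y div h}"
  proof
    fix m assume m: "m \<in> generated_upto h Y"
    have "[m = 1] (mod h)"
    proof (rule cong_1_if_prime_factors)
      fix p assume "prime p" "p dvd m"
      then have "p \<in> order_primes h" using m by (auto simp: generated_by_def in_prime_factors_iff)
      then obtain i where "p = i * h + 1" using order_primes_form assms by blast
      then show "[p = 1] (mod h)" by (simp only: cong_def mod_mult_self3)
    qed (use m in auto)
    then have "h dvd m - 1" using cong_to_1_nat by blast
    then obtain i where i: "m - 1 = h * i" by blast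
    then have "m = i * h + 1" "i > 0" using m by (auto intro: Nat.gr0I simp: mult.commute)
    moreover have "i \<le> Y div h" using calculation m assms by (auto simp: less_eq_div_iff_mult_less_eq)
    ultimately show "m \<in> (\<lambda>i. i * h + 1) ` {1..Y div h}" by auto
  qed
  then have "card (generated_upto h Y) \<le> card {1..Y div h}"
    by (meson surj_card_le finite_atLeastAtMost)
  then have "real (card (generated_upto h Y)) \<le> real (Y div h)" by simp
  also have "\<dots> \<le> real Y / real h" by (rule of_nat_div_le_of_nat)
  finally show ?thesis .
qed

text \<open>This is the geometric mean of the bounds \<open>exp 6 * sqrt Y\<close> and
  \<open>Y / h\<close>. Together with the \<open>1 / h\<close> from the later sum over primes, its
  factor \<open>h powr (-1/2)\<close> makes a series in \<open>h\<close> that converges.\<close>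

lemma card_generated_upto_le_powr:
  assumes "h > 0"
  shows "real (card (generated_upto h Y)) \<le> exp 3 * real Y powr (3/4) * real h powr (-1/2)"
proof -
  define N where "N = real (card (generated_upto h Y))"
  have "N \<le> sqrt (real Y) * exp 6"
    using card_generated_upto_le_sqrt[OF assms, of Y] rankin_const_bounds[OF assms]
      mult_left_mono[of "rankin_const h" "exp 6" "sqrt (real Y)"] by (simp add: N_def)
  moreover have "N \<le> real Y / real h" using card_generated_upto_le_div[OF assms] by (simp add: N_def)
  ultimately have "N * N \<le> (sqrt (real Y) * exp 6) * (real Y / real h)"
    by (intro mult_mono) (auto simp: N_def)
  also have "\<dots> = (exp 3 * real Y powr (3/4) * real h powr (-1/2))\<^sup>2"
  proof -
    have "(real Y powr (3/4))\<^sup>2 = sqrt (real Y) * real Y"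
      by (cases "Y = 0") (auto simp: power2_eq_square powr_half_sqrt[symmetric] powr_mult_base mult.commute simp flip: powr_add)
    moreover have "(real h powr (-1/2))\<^sup>2 = 1 / real h"
      using assms by (simp add: power2_eq_square powr_minus_divide flip: powr_add)
    moreover have "(exp 3)\<^sup>2 = (exp 6 :: real)" by (simp add: power2_eq_square flip: exp_add)
    ultimately show ?thesis by (simp add: power_mult_distrib)
  qed
  finally have "N\<^sup>2 \<le> (exp 3 * real Y powr (3/4) * real h powr (-1/2))\<^sup>2"
    by (simp add: power2_eq_square)
  then show ?thesis unfolding N_def[symmetric] by (rule power2_le_imp_le) simp
qed

section \<open>Composite integers whose prime factors all have order h\<close>

text \<open>The primes are among the numbers \<open>i * h + 1\<close> with
  \<open>1 \<le> i \<le> sqrt X / h\<close>, so the sum is at most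
  \<open>h powr (-3/4) * 4 * (sqrt X / h) powr (1/4)\<close>.\<close>

lemma sum_order_primes_powr_le:
  assumes "h > 0"
  shows "(\<Sum>p | p \<in> order_primes h \<and> p * p \<le> X. real p powr (-3/4)) \<le> 4 * real X powr (1/8) / real h"
proof -
  let ?P = "{p \<in> order_primes h. p * p \<le> X}"
  define n where "n = nat \<lfloor>sqrt (real X) / real h\<rfloor>"
  have n: "real n \<le> sqrt (real X) / real h" by (simp add: n_def)
  have fin: "finite ?P" using order_primes_card(1)[OF assms] by simp
  have sub: "?P \<subseteq> (\<lambda>i. i * h + 1) ` {1..n}"
  proof
    fix p assume p: "p \<in> ?P"
    then obtain i where i: "i > 0" "p = i * h + 1" using order_primes_form assms by blast
    have "real p * real p \<le> real X" using p by (metis (mono_tags) mem_Collect_eq of_nat_le_iff of_nat_mult)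
    then have "real p \<le> sqrt (real X)" by (intro real_le_rsqrt) (simp add: power2_eq_square)
    then have "real i \<le> sqrt (real X) / real h" using i assms by (simp add: field_simps)
    then have "i \<le> n" by (simp add: n_def le_nat_floor)
    then show "p \<in> (\<lambda>i. i * h + 1) ` {1..n}" using i by auto
  qed
  have "(\<Sum>p\<in>?P. real p powr (-3/4)) \<le> (\<Sum>p\<in>(\<lambda>i. i * h + 1) ` {1..n}. real p powr (-3/4))"
    using sub by (intro sum_mono2) auto
  also have "\<dots> = (\<Sum>i=1..n. real (i * h + 1) powr (-3/4))"
    using assms by (subst sum.reindex) (auto simp: inj_on_def)
  also have "\<dots> \<le> (\<Sum>i=1..n. real h powr (-3/4) * real i powr (-3/4))"
  proof (rule sum_mono)
    fix i assume i: "i \<in> {1..n}"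
    have "real (i * h + 1) powr (-3/4) \<le> (real h * real i) powr (-3/4)"
      using i assms by (intro powr_mono2') auto
    then show "real (i * h + 1) powr (-3/4) \<le> real h powr (-3/4) * real i powr (-3/4)"
      by (simp add: powr_mult)
  qed
  also have "\<dots> \<le> real h powr (-3/4) * (4 * real n powr (1/4))"
    unfolding sum_distrib_left[symmetric] by (intro mult_left_mono sum_powr_three_quarters_le) simp
  also have "\<dots> \<le> real h powr (-3/4) * (4 * (sqrt (real X) / real h) powr (1/4))"
    using n by (intro mult_left_mono powr_mono2) auto
  also have "\<dots> = 4 * real X powr (1/8) / real h"
  proof -
    have "real h powr (3/4) * real h powr (1/4) = real h" using assms by (simp flip: powr_add)
    then show ?thesis
      using assms by (simp add: powr_divide powr_minus_divide powr_half_sqrt[symmetric] powr_powr field_simps)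
  qed
  finally show ?thesis by simp
qed

lemma composite_prime_factor_square_le:
  fixes n :: nat
  assumes "n > 1" "\<not> prime n"
  obtains p where "prime p" "p dvd n" "p * p \<le> n"
proof -
  obtain a where a: "a dvd n" "a \<noteq> 1" "a \<noteq> n" using assms prime_nat_iff by blast
  then obtain b where b: "n = a * b" by blast
  then have "a > 1" "b > 1" using a assms(1) by (cases "a = 0"; cases "b = 0 \<or> b = 1"; force)+
  with b have ab: "n = a * b" "1 < a" "1 < b" by auto
  define c where "c = min a b"
  have c: "c dvd n" "c \<noteq> 1" "c * c \<le> n" using ab by (auto simp: c_def min_def)
  obtain p where p: "prime p" "p dvd c" using prime_factor_nat c by blast
  have "p \<le> c" using p ab by (intro dvd_imp_le) (auto simp: c_def)
  then have "p * p \<le> c * c" by (intro mult_mono) auto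
  with c p show ?thesis by (intro that[of p]) (auto intro: dvd_trans)
qed

lemma card_composite_generated_upto_le:
  assumes "h > 0"
  shows "real (card {n \<in> generated_upto h X. \<not> prime n})
    \<le> 4 * exp 3 * real X powr (7/8) * real h powr (-3/2)"
proof -
  let ?P = "{p \<in> order_primes h. p * p \<le> X}"
  have fin: "finite ?P" using order_primes_card(1)[OF assms] by simp
  have "{n \<in> generated_upto h X. \<not> prime n} \<subseteq> (\<Union>p\<in>?P. (*) p ` generated_upto h (X div p))"
  proof
    fix n assume n: "n \<in> {n \<in> generated_upto h X. \<not> prime n}"
    then obtain p where p: "prime p" "p dvd n" "p * p \<le> n"
      using composite_prime_factor_square_le by blast
    then obtain k where k: "n = p * k" by blast
    \<comment> \<open>Compositeness enters here: \<open>k = 1\<close> would make \<open>n\<close>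
      the prime \<open>p\<close>, and the counts of cofactors exclude 1.\<close>
    have "k > 1" using n k p by (cases "k = 0 \<or> k = 1") auto
    moreover have "k \<le> X div p" using n k p prime_gt_0_nat[OF p(1)]
      by (simp add: less_eq_div_iff_mult_less_eq mult.commute)
    moreover have "k \<in> generated_by (order_primes h)"
      using n k dvd_prime_factors[of n k] calculation by (auto simp: generated_by_def)
    moreover have "p \<in> ?P" using n p by (auto simp: generated_by_def in_prime_factors_iff)
    ultimately show "n \<in> (\<Union>p\<in>?P. (*) p ` generated_upto h (X div p))" using k by blast
  qed
  then have "card {n \<in> generated_upto h X. \<not> prime n} \<le> card (\<Union>p\<in>?P. (*) p ` generated_upto h (X div p))"
    using fin finite_generated_upto by (intro card_mono) auto
  also have "\<dots> \<le> (\<Sum>p\<in>?P. card (generated_upto h (X div p)))"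
    by (rule order_trans[OF card_UN_le[OF fin]]) (intro sum_mono card_image_le finite_generated_upto)
  finally have "real (card {n \<in> generated_upto h X. \<not> prime n}) \<le> (\<Sum>p\<in>?P. real (card (generated_upto h (X div p))))"
    unfolding of_nat_sum[symmetric] of_nat_le_iff .
  also have "\<dots> \<le> (\<Sum>p\<in>?P. exp 3 * real X powr (3/4) * real h powr (-1/2) * real p powr (-3/4))"
  proof (rule sum_mono)
    fix p assume "p \<in> ?P"
    have "real (X div p) powr (3/4) \<le> (real X / real p) powr (3/4)"
      by (intro powr_mono2 of_nat_div_le_of_nat) auto
    then have "exp 3 * real (X div p) powr (3/4) * real h powr (-1/2)
      \<le> exp 3 * (real X / real p) powr (3/4) * real h powr (-1/2)"
      by (intro mult_right_mono mult_left_mono) auto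
    also have "\<dots> = exp 3 * real X powr (3/4) * real h powr (-1/2) * real p powr (-3/4)"
      by (simp add: powr_divide powr_minus_divide)
    finally show "real (card (generated_upto h (X div p)))
      \<le> exp 3 * real X powr (3/4) * real h powr (-1/2) * real p powr (-3/4)"
      using card_generated_upto_le_powr[OF assms, of "X div p"] by linarith
  qed
  also have "\<dots> \<le> exp 3 * real X powr (3/4) * real h powr (-1/2) * (4 * real X powr (1/8) / real h)"
    unfolding sum_distrib_left[symmetric]
    by (intro mult_left_mono sum_order_primes_powr_le assms) auto
  also have "\<dots> = 4 * exp 3 * (real X powr (3/4) * real X powr (1/8)) * (real h powr (-1/2) / real h)"
    by simp
  also have "real X powr (3/4) * real X powr (1/8) = real X powr (7/8)" by (simp flip: powr_add)
  also have "real h powr (-1/2) / real h = real h powr (-3/2)"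
    using assms powr_diff[of "real h" "-1/2" 1] by simp
  finally show ?thesis .
qed

section \<open>Counting overpseudoprimes\<close>

lemma overpseudoprime_mem_generated_upto:
  assumes "overpseudoprime n" "n \<le> X"
  shows "n \<in> generated_upto (ord n 2) X" "0 < ord n 2" "ord n 2 \<le> X" "\<not> prime n"
proof -
  have n: "odd n" "n > 1" "\<not> prime n" using assms by (auto simp: overpseudoprime_def)
  then show "\<not> prime n" "0 < ord n 2" by auto
  have "ord n 2 \<le> totient n" using n order_divides_totient[of n 2] by (auto intro!: dvd_imp_le)
  also have "totient n \<le> n" by (rule totient_le)
  finally show "ord n 2 \<le> X" using assms by simp
  show "n \<in> generated_upto (ord n 2) X"
    using n assms overpseudoprime_ord_prime_factor[OF assms(1)]
    by (auto simp: generated_by_def order_primes_def in_prime_factors_iff)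
qed

text \<open>Orders up to \<open>H\<close> are handled by the Rankin bound, larger ones by the bound
  for composites, whose tail over \<open>h > H\<close> contributes \<open>2 / sqrt H\<close>. The
  cut \<open>H\<close> stays free for later optimisation.\<close>

lemma card_overpseudoprimes_le:
  assumes "H > 0"
  shows "real (card {n. overpseudoprime n \<and> n \<le> X})
    \<le> sqrt (real X) * (\<Sum>h=1..H. rankin_const h) + 8 * exp 3 * real X powr (7/8) / sqrt (real H)"
proof -
  let ?C = "\<lambda>h. {n \<in> generated_upto h X. \<not> prime n}"
  let ?A = "\<Union>h\<in>{1..H}. generated_upto h X" and ?B = "\<Union>h\<in>{H<..X}. ?C h"
  have fin: "finite ?A" "finite ?B" using finite_generated_upto by auto
  have "{n. overpseudoprime n \<and> n \<le> X} \<subseteq> ?A \<union> ?B"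
  proof
    fix n assume "n \<in> {n. overpseudoprime n \<and> n \<le> X}"
    then have n: "n \<in> generated_upto (ord n 2) X" "0 < ord n 2" "ord n 2 \<le> X" "\<not> prime n"
      using overpseudoprime_mem_generated_upto by auto
    show "n \<in> ?A \<union> ?B"
    proof (cases "ord n 2 \<le> H")
      case True
      then have "ord n 2 \<in> {1..H}" using n(2) by (simp only: atLeastAtMost_iff Suc_le_eq One_nat_def simp_thms)
      then show ?thesis using n(1) by blast
    next
      case False
      then have "ord n 2 \<in> {H<..X}" using n(3) by simp
      then show ?thesis using n(1,4) by blast
    qed
  qed
  then have "card {n. overpseudoprime n \<and> n \<le> X} \<le> card (?A \<union> ?B)"
    using fin by (intro card_mono) auto
  also have "\<dots> \<le> card ?A + card ?B" by (rule card_Un_le)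
  also have "\<dots> \<le> (\<Sum>h=1..H. card (generated_upto h X)) + (\<Sum>h\<in>{H<..X}. card (?C h))"
    by (intro add_mono card_UN_le) auto
  finally have "real (card {n. overpseudoprime n \<and> n \<le> X})
    \<le> (\<Sum>h=1..H. real (card (generated_upto h X))) + (\<Sum>h\<in>{H<..X}. real (card (?C h)))"
    unfolding of_nat_sum[symmetric] of_nat_add[symmetric] of_nat_le_iff .
  also have "(\<Sum>h=1..H. real (card (generated_upto h X))) \<le> (\<Sum>h=1..H. sqrt (real X) * rankin_const h)"
    by (intro sum_mono card_generated_upto_le_sqrt) auto
  also have "(\<Sum>h=1..H. sqrt (real X) * rankin_const h) = sqrt (real X) * (\<Sum>h=1..H. rankin_const h)"
    by (simp add: sum_distrib_left)
  also have "(\<Sum>h\<in>{H<..X}. real (card (?C h)))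
    \<le> (\<Sum>h\<in>{H<..X}. 4 * exp 3 * real X powr (7/8) * real h powr (-3/2))"
    by (intro sum_mono card_composite_generated_upto_le) auto
  also have "\<dots> \<le> 4 * exp 3 * real X powr (7/8) * (2 / sqrt (real H))"
    unfolding sum_distrib_left[symmetric]
    by (intro mult_left_mono sum_powr_three_halves_tail_le assms) auto
  finally show ?thesis by simp
qed

text \<open>A Cesaro argument: the averages of a null sequence tend to 0. The terms below
  \<open>h0\<close> cost at most the constant \<open>h0 * exp 6\<close>, the others at most
  \<open>\<delta> / 2\<close> each.\<close>

lemma sum_rankin_const_le:
  assumes "\<delta> > 0"
  shows "eventually (\<lambda>H. (\<Sum>h=1..H. rankin_const h) \<le> \<delta> * real H) sequentially"
proof -
  have "eventually (\<lambda>h. rankin_const h < \<delta> / 2) sequentially"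
    using rankin_const_tendsto assms by (intro order_tendstoD) auto
  then obtain h0 where h0: "\<And>h. h \<ge> h0 \<Longrightarrow> rankin_const h < \<delta> / 2"
    by (auto simp: eventually_sequentially)
  have bound: "(\<Sum>h=1..H. rankin_const h) \<le> real h0 * exp 6 + \<delta> / 2 * real H" for H
  proof -
    have "(\<Sum>h=1..H. rankin_const h) \<le> (\<Sum>h=1..H. (if h < h0 then exp 6 else 0) + \<delta> / 2)"
    proof (rule sum_mono)
      fix h assume "h \<in> {1..H}"
      then have "rankin_const h \<le> exp 6" using rankin_const_bounds by simp
      then show "rankin_const h \<le> (if h < h0 then exp 6 else 0) + \<delta> / 2"
        using h0[of h] assms by (auto simp: not_less)
    qed
    also have "\<dots> = (\<Sum>h=1..H. if h < h0 then exp 6 else 0) + \<delta> / 2 * real H"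
      by (simp add: sum.distrib)
    also have "(\<Sum>h=1..H. if h < h0 then exp 6 else 0) = (\<Sum>h\<in>{h\<in>{1..H}. h < h0}. exp 6 :: real)"
      by (subst sum.inter_filter) auto
    also have "\<dots> \<le> (\<Sum>h<h0. exp 6)" by (intro sum_mono2) auto
    finally show ?thesis by simp
  qed
  have "eventually (\<lambda>H::nat. real h0 * exp 6 \<le> \<delta> / 2 * real H) sequentially"
    using assms by real_asymp
  then show ?thesis
  proof eventually_elim
    case (elim H)
    then show ?case using bound[of H] by simp
  qed
qed

lemma Ov_eventually_le:
  assumes "\<delta> > 0"
  shows "eventually (\<lambda>x. real (Ov x) \<le> \<delta> * x powr (3/4)) at_top"
proof -
  \<comment> \<open>\<open>U\<close> solves \<open>8 * exp 3 / sqrt U = \<delta> / 2\<close>, so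
    that the large orders contribute at most \<open>\<delta> / 2 * x powr (3/4)\<close>.\<close>
  define U where "U = (16 * exp 3 / \<delta>)\<^sup>2"
  have U: "U > 0" "sqrt U = 16 * exp 3 / \<delta>" using assms by (auto simp: U_def)
  define H where "H = (\<lambda>x::real. nat \<lceil>U * x powr (1/4)\<rceil>)"
  have "filterlim H sequentially at_top" unfolding H_def using U by real_asymp
  \<comment> \<open>With \<open>U\<close> fixed, this threshold for the averages together with
    \<open>H x \<le> 2 * U * x powr (1/4)\<close> leaves the other \<open>\<delta> / 2\<close> for
    the small orders.\<close>
  moreover have "\<delta> / (4 * U) > 0" using assms U by simp
  then have "\<forall>\<^sub>F H in sequentially. (\<Sum>h=1..H. rankin_const h) \<le> \<delta> / (4 * U) * real H"
    by (rule sum_rankin_const_le)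
  ultimately have ev1: "eventually (\<lambda>x. (\<Sum>h=1..H x. rankin_const h) \<le> \<delta> / (4 * U) * real (H x)) at_top"
    by (rule eventually_compose_filterlim[rotated])
  \<comment> \<open>This absorbs the 1 lost to the ceiling in \<open>H\<close>.\<close>
  have ev2: "eventually (\<lambda>x. 1 \<le> U * x powr (1/4)) at_top" using U by real_asymp
  show ?thesis using ev1 ev2 eventually_gt_at_top[of 0]
  proof eventually_elim
    case (elim x)
    define X where "X = nat \<lfloor>x\<rfloor>"
    have X: "real X \<le> x" using elim by (simp add: X_def)
    have "(real n \<le> x) = (n \<le> X)" for n using elim by (simp add: X_def le_nat_iff le_floor_iff)
    then have Ov: "Ov x = card {n. overpseudoprime n \<and> n \<le> X}" by (simp add: Ov_def)
    have Hge: "U * x powr (1/4) \<le> real (H x)" unfolding H_def by (rule real_nat_ceiling_ge)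
    have "real (H x) \<le> U * x powr (1/4) + 1" using elim by (simp add: H_def)
    then have Hle: "real (H x) \<le> 2 * U * x powr (1/4)" using elim by linarith
    have H0: "H x > 0" using Hge elim by (auto intro: Nat.gr0I)
    have nonneg: "0 \<le> (\<Sum>h=1..H x. rankin_const h)" by (intro sum_nonneg rankin_const_bounds) auto
    have "sqrt (real X) * (\<Sum>h=1..H x. rankin_const h) \<le> sqrt x * (\<delta> / (4 * U) * (2 * U * x powr (1/4)))"
    proof (rule mult_mono)
      have "\<delta> / (4 * U) * real (H x) \<le> \<delta> / (4 * U) * (2 * U * x powr (1/4))"
        using Hle assms U by (intro mult_left_mono) auto
      then show "(\<Sum>h=1..H x. rankin_const h) \<le> \<delta> / (4 * U) * (2 * U * x powr (1/4))"
        using elim(1) by linarith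
    qed (use X elim nonneg in auto)
    also have "\<dots> = \<delta> / 2 * (x powr (1/2) * x powr (1/4))"
      using U elim by (simp add: powr_half_sqrt)
    also have "x powr (1/2) * x powr (1/4) = x powr (3/4)" by (simp flip: powr_add)
    finally have 1: "sqrt (real X) * (\<Sum>h=1..H x. rankin_const h) \<le> \<delta> / 2 * x powr (3/4)" .
    have "8 * exp 3 * real X powr (7/8) / sqrt (real (H x)) \<le> 8 * exp 3 * x powr (7/8) / sqrt (U * x powr (1/4))"
      using X Hge U elim by (intro frac_le mult_left_mono powr_mono2) auto
    also have "sqrt (U * x powr (1/4)) = 16 * exp 3 / \<delta> * x powr (1/8)"
      using U elim by (simp add: real_sqrt_mult powr_half_sqrt[symmetric] powr_powr)
    also have "8 * exp 3 * x powr (7/8) / (16 * exp 3 / \<delta> * x powr (1/8)) = \<delta> / 2 * (x powr (7/8) / x powr (1/8))"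
      using assms elim by (simp add: field_simps)
    also have "x powr (7/8) / x powr (1/8) = x powr (3/4)" by (simp flip: powr_diff)
    finally have 2: "8 * exp 3 * real X powr (7/8) / sqrt (real (H x)) \<le> \<delta> / 2 * x powr (3/4)" .
    show ?case unfolding Ov using card_overpseudoprimes_le[OF H0, of X] 1 2 by linarith
  qed
qed

theorem theorem3:
  shows "\<exists>\<epsilon> :: real \<Rightarrow> real. \<epsilon> \<in> o[at_top](\<lambda>_. 1) \<and>
    (\<forall>\<^sub>F x in at_top. real (Ov x) \<le> x powr (3/4) * (1 + \<epsilon> x))"
proof (intro exI conjI)
  \<comment> \<open>Since \<open>Ov x\<close> is even \<open>o(x powr (3/4))\<close>, the ratio
    itself can serve as the error term; the inequality then only says that it is at most 1 plus
    itself.\<close>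
  let ?e = "\<lambda>x. real (Ov x) / x powr (3/4)"
  show "?e \<in> o[at_top](\<lambda>_. 1)"
  proof (rule landau_o.smallI)
    fix c :: real assume "c > 0"
    from Ov_eventually_le[OF this] eventually_gt_at_top[of 0]
    show "\<forall>\<^sub>F x in at_top. norm (?e x) \<le> c * norm (1::real)"
      by eventually_elim (simp add: field_simps)
  qed
  show "\<forall>\<^sub>F x in at_top. real (Ov x) \<le> x powr (3/4) * (1 + ?e x)"
    using eventually_gt_at_top[of 0] by eventually_elim (simp add: field_simps)
qed

end
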